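(* Let $n\in\mathbb{N}$ and let $A,B,D,E,G\in\mathbb{C}$ satisfy $A+B+D+(1-G)+(1-E)=0$. Put $$ \hat\zeta=\frac{ABD}{AB+AD+BD-(1-G)(1-E)} . $$ Then $$ \left[{}_{4}F_{3}\left(\begin{matrix} A,B,D,\hat\zeta+1 \\ G,E,\hat\zeta \end{matrix}\right)\right]_{n}=\frac{(A+1)_n(B+1)_n(D+1)_n}{(G)_n(E)_n\,n!}, $$ where $[\,\cdot\,]_n$ denotes the hypergeometric series at unit argument truncated at the $n$-th term, i.e. the left-hand side is $\sum_{j=0}^{n}\frac{(A)_j(B)_j(D)_j(\hat\zeta+1)_j}{(G)_j(E)_j(\hat\zeta)_j\,j!}$.
   Context: $(a)_n=\Gamma(a+n)/\Gamma(a)$ is the Pochhammer symbol. Lower parameters are assumed never to be non-positive integers, and the denominator in the definition of $\hat\zeta$ is assumed non-zero. *)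

theory Defs
  imports "HOL-Analysis.Analysis"
begin

(* pochhammer a n = a (a+1) ... (a+n-1); by pochhammer_Gamma this is Gamma (a+n) / Gamma a unless a is
   a non-positive integer, where that quotient is to be read as its continuous extension. *)

definition hypergeo_trunc :: "complex list \<Rightarrow> complex list \<Rightarrow> nat \<Rightarrow> complex" where
  "hypergeo_trunc as bs n = (\<Sum>j\<le>n. fps_nth (fps_hypergeo as bs 1) j)"

lemma hypergeo_trunc_4_3:
  "hypergeo_trunc [a1, a2, a3, a4] [b1, b2, b3] n =
    (\<Sum>j\<le>n. pochhammer a1 j * pochhammer a2 j * pochhammer a3 j * pochhammer a4 j /
      (pochhammer b1 j * pochhammer b2 j * pochhammer b3 j * fact j))"
  by (simp add: hypergeo_trunc_def)

end

(* The right-hand side telescopes: with c = AB + AD + BD - (1-G)(1-E), the choice of \<zeta> says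
   ABD = \<zeta> c, so the factor ABD (\<zeta> + m) / \<zeta> of the m-th summand is the linear polynomial ABD + c m, and the
   balance condition makes it equal to (A+m)(B+m)(D+m) - (G+m-1)(E+m-1) m. *)

theory Submission
  imports Defs
begin

lemma pochhammer_nonzero:
  fixes a :: "'a :: field_char_0"
  assumes "a \<notin> \<int>\<^sub>\<le>\<^sub>0"
  shows "pochhammer a n \<noteq> 0"
  using assms by (auto simp: pochhammer_eq_0_iff)

theorem mainTheorem6:
  fixes n :: nat and A B D E G \<zeta> :: complex
  assumes balance: "A + B + D + (1 - G) + (1 - E) = 0"
    and denom: "A * B + A * D + B * D - (1 - G) * (1 - E) \<noteq> 0"
    and zeta: "\<zeta> = A * B * D / (A * B + A * D + B * D - (1 - G) * (1 - E))"
    and lower: "G \<notin> \<int>\<^sub>\<le>\<^sub>0" "E \<notin> \<int>\<^sub>\<le>\<^sub>0" "\<zeta> \<notin> \<int>\<^sub>\<le>\<^sub>0"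
  shows "hypergeo_trunc [A, B, D, \<zeta> + 1] [G, E, \<zeta>] n =
    pochhammer (A + 1) n * pochhammer (B + 1) n * pochhammer (D + 1) n /
      (pochhammer G n * pochhammer E n * fact n)"
  unfolding hypergeo_trunc_4_3
proof (induction n)
  case 0
  show ?case by simp
next
  case (Suc n)
  define c where "c = A * B + A * D + B * D - (1 - G) * (1 - E)"
  \<comment> \<open>\<open>m\<close> is the index of the new summand, while \<open>a\<close>, ...,
    \<open>z\<close> stop at index \<open>n\<close>. Hence the last factor of a symbol based at
    \<open>G\<close> or \<open>E\<close> is \<open>G + m - 1\<close> or \<open>E + m - 1\<close>,
    but one based at \<open>A + 1\<close> ends in \<open>A + m\<close>.\<close>
  define m :: complex where "m = of_nat (Suc n)"
  define a b d g e f z where "a = pochhammer (A + 1) n" and "b = pochhammer (B + 1) n"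
    and "d = pochhammer (D + 1) n" and "g = pochhammer G n" and "e = pochhammer E n"
    and "f = (fact n :: complex)" and "z = pochhammer (\<zeta> + 1) n"
  note defs = a_def b_def d_def g_def e_def f_def z_def
  have zc: "A * B * D = \<zeta> * c"
    using zeta denom by (simp add: c_def)
  have G_Suc: "pochhammer G (Suc n) = g * (G + m - 1)"
    and E_Suc: "pochhammer E (Suc n) = e * (E + m - 1)"
    by (simp_all add: defs m_def pochhammer_Suc)
  have zeta_Suc: "pochhammer \<zeta> (Suc n) = \<zeta> * z"
    by (simp add: defs pochhammer_rec)
  \<comment> \<open>Taking the symbols at \<open>Suc n\<close> rather than \<open>n\<close> also
    yields that the new factors and \<zeta> itself are nonzero.\<close>
  have nz: "g * (G + m - 1) \<noteq> 0" "e * (E + m - 1) \<noteq> 0" "\<zeta> * z \<noteq> 0"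
    using pochhammer_nonzero[OF lower(1)] pochhammer_nonzero[OF lower(2)]
      pochhammer_nonzero[OF lower(3)] G_Suc E_Suc zeta_Suc by metis+
  have m: "m \<noteq> 0" and f: "f \<noteq> 0"
    by (simp_all add: m_def f_def del: of_nat_Suc)
  \<comment> \<open>Eliminating \<open>E\<close> turns the balance condition into a substitution, so
    that \<open>key\<close> becomes a polynomial identity in \<open>A\<close>, \<open>B\<close>,
    \<open>D\<close>, \<open>G\<close> and \<open>m\<close>. The condition matches the coefficients
    of the square of \<open>m\<close>; \<open>c\<close> and \<open>A * B * D\<close> account for the
    two lower ones.\<close>
  have E_eq: "E = A + B + D + 2 - G"
    using balance by (simp add: algebra_simps eq_diff_eq)
  have key: "(A + m) * (B + m) * (D + m) = (G + m - 1) * (E + m - 1) * m + c * (\<zeta> + m)"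
  proof -
    have "(A + m) * (B + m) * (D + m) = (G + m - 1) * (E + m - 1) * m + (A * B * D + c * m)"
      unfolding c_def E_eq by algebra
    then show ?thesis
      unfolding zc by (simp add: algebra_simps)
  qed
  \<comment> \<open>The symbols at \<open>A\<close>, \<open>B\<close>, \<open>D\<close> lose their
    first factor, which leaves the shifted symbols of the closed form; the one at \<zeta> + 1 loses
    its last.\<close>
  have "pochhammer A (Suc n) * pochhammer B (Suc n) * pochhammer D (Suc n) *
      pochhammer (\<zeta> + 1) (Suc n) = (A * B * D) * (a * b * d) * (z * (\<zeta> + m))"
  proof -
    have "pochhammer (\<zeta> + 1) (Suc n) = z * (\<zeta> + m)"
      by (simp add: defs m_def pochhammer_Suc add_ac)
    then show ?thesis
      by (simp add: defs pochhammer_rec[of A] pochhammer_rec[of B] pochhammer_rec[of D] mult_ac)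
  qed
  \<comment> \<open>With \<open>A * B * D\<close> replaced by \<zeta> \<open>* c\<close>, the factor
    \<zeta> \<open>* z\<close> cancels against the lower symbol at \<zeta>.\<close>
  then have summand: "pochhammer A (Suc n) * pochhammer B (Suc n) * pochhammer D (Suc n) *
        pochhammer (\<zeta> + 1) (Suc n) /
        (pochhammer G (Suc n) * pochhammer E (Suc n) * pochhammer \<zeta> (Suc n) * fact (Suc n)) =
      a * b * d * (c * (\<zeta> + m)) / (g * (G + m - 1) * (e * (E + m - 1)) * (m * f))"
    unfolding zc G_Suc E_Suc zeta_Suc using nz by (simp add: m_def f_def mult_ac)
  \<comment> \<open>The closed form at \<open>n\<close> is expanded to the denominator of the new
    summand, so that \<open>key\<close> can add the numerators.\<close>
  have "a * b * d / (g * e * f) =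
      a * b * d * ((G + m - 1) * (E + m - 1) * m) /
        (g * (G + m - 1) * (e * (E + m - 1)) * (m * f))"
  proof -
    have "(G + m - 1) * (E + m - 1) * m \<noteq> 0"
      using nz m by simp
    from nonzero_mult_divide_mult_cancel_right[OF this, of "a * b * d" "g * e * f", symmetric]
    show ?thesis
      by (simp only: mult_ac)
  qed
  then have "a * b * d / (g * e * f) +
        a * b * d * (c * (\<zeta> + m)) / (g * (G + m - 1) * (e * (E + m - 1)) * (m * f)) =
      a * b * d * ((A + m) * (B + m) * (D + m)) /
        (g * (G + m - 1) * (e * (E + m - 1)) * (m * f))"
    by (simp only: key add_divide_distrib [symmetric] distrib_left [symmetric])
  also have "\<dots> = pochhammer (A + 1) (Suc n) * pochhammer (B + 1) (Suc n) *
      pochhammer (D + 1) (Suc n) / (pochhammer G (Suc n) * pochhammer E (Suc n) * fact (Suc n))"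
  proof -
    have "pochhammer (A + 1) (Suc n) = a * (A + m)" "pochhammer (B + 1) (Suc n) = b * (B + m)"
      "pochhammer (D + 1) (Suc n) = d * (D + m)" "fact (Suc n) = m * f"
      by (simp_all add: defs m_def pochhammer_Suc add_ac)
    then show ?thesis
      unfolding G_Suc E_Suc by (simp only: mult_ac)
  qed
  finally show ?case
    unfolding sum.atMost_Suc Suc.IH summand unfolding defs .
qed

end
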